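(* Let $m\ge 1$ be an integer. The cycle index $\mathcal{Z}=\mathcal{Z}_{(\mathcal{U}_{2^m},\mathbb{Z}_{2^m})}$ of the permutation group $\mathcal{U}_{2^m}$ acting on $\mathbb{Z}_{2^m}$ is as follows: - $\mathcal{Z}=x_1^2$ if $m=1$; - $\mathcal{Z}=\frac12\left(x_1^4+x_1^2x_2\right)$ if $m=2$; - $\mathcal{Z}=\frac{1}{2^{m-1}}\left(\mathcal{Z}_1+\mathcal{Z}_2\right)$ if $m\ge 3$, where $$\mathcal{Z}_1=x_1^{2^m}+2^{m-3}x_1^2x_2\prod_{l=3}^m x_{2^{l-2}}^2+\sum_{t=0}^{m-4}2^t x_1^{2^{m-1-t}}\prod_{i=0}^t x_{2^{i+1}}^{2^{m-2-t}},$$ $$\mathcal{Z}_2=x_1^2x_2^{2^m-2}+2^{m-3}x_1^4\prod_{l=3}^m x_{2^{l-2}}^2+x_1^2\sum_{t=0}^{m-4}2^t x_2^{2^{m-t-1}-1}\prod_{i=1}^t x_{2^{i+1}}^{2^{m-t-2}}.$$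
   Context: $\mathbb{Z}_n$ is the set of residues modulo $n$. $\mathcal{U}_n=\mathrm{Aut}(\mathbb{Z}_n)$ is identified with the set of residues $a$ modulo $n$ with $\gcd(a,n)=1$, where $a$ corresponds to the map $\pi_a(x)=ax \pmod n$; it acts on the $n$ points of $\mathbb{Z}_n$ by multiplication. For a permutation $\pi$ of a finite set with $N$ elements, $\mathrm{ctype}(\pi)=\prod_{i=1}^N x_i^{\lambda_i(\pi)}$, where $x_1,x_2,\dots$ are formal indeterminates and $\lambda_i(\pi)$ is the number of cycles of length $i$ (fixed points counted as cycles of length 1) in the disjoint cycle decomposition of $\pi$. The cycle index of a finite permutation group $G$ on a finite set $P$ is $\mathcal{Z}_{(G,P)}=\frac{1}{|G|}\sum_{\pi\in G}\mathrm{ctype}(\pi)$. Empty sums are $0$ and empty products are $1$.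
   Formalization: In the first term of Z_2 the exponent of x_2 is corrected from 2^m-2 to 2^(m-1)-1; as printed the formula is false for every m >= 3, since that term has weight 2^(m+1)-2 instead of 2^m. *)

theory Defs
  imports
    Complex_Main
    "HOL-Library.Poly_Mapping"
    "HOL-Combinatorics.Combinatorics"
    "HOL-Number_Theory.Number_Theory"
begin

(* Polynomials over the rationals in indeterminates x_1, x_2, ...: finitely supported maps from
   exponent vectors to coefficients, with the convolution product of Poly_Mapping. *)
type_synonym cpoly = "(nat \<Rightarrow>\<^sub>0 nat) \<Rightarrow>\<^sub>0 rat"

definition indet :: "nat \<Rightarrow> cpoly" where
  "indet i = Poly_Mapping.single (Poly_Mapping.single i 1) 1"

definition const_poly :: "rat \<Rightarrow> cpoly" where
  "const_poly c = Poly_Mapping.single 0 c"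

(* The cycles of a permutation p of a finite set P are its orbits; a fixed point x has
   orbit p x = {x}, so it counts as a cycle of length 1. *)
definition cycle_count :: "('a \<Rightarrow> 'a) \<Rightarrow> 'a set \<Rightarrow> nat \<Rightarrow> nat" where
  "cycle_count p P i = card {C \<in> orbit p ` P. card C = i}"

definition ctype :: "('a \<Rightarrow> 'a) \<Rightarrow> 'a set \<Rightarrow> cpoly" where
  "ctype p P = (\<Prod>i = 1..card P. indet i ^ cycle_count p P i)"

(* To be used for a finite set P and a group G of maps p with p permutes P. *)
definition cycle_index :: "('a \<Rightarrow> 'a) set \<Rightarrow> 'a set \<Rightarrow> cpoly" where
  "cycle_index G P = const_poly (1 / of_nat (card G)) * (\<Sum>p\<in>G. ctype p P)"

definition residues_mod :: "nat \<Rightarrow> nat set" where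
  "residues_mod n = {0..<n}"

(* The identity outside the residues, as required by (permutes). *)
definition mult_perm :: "nat \<Rightarrow> nat \<Rightarrow> nat \<Rightarrow> nat" where
  "mult_perm n a = (\<lambda>x. if x \<in> residues_mod n then (a * x) mod n else x)"

definition unit_perms :: "nat \<Rightarrow> (nat \<Rightarrow> nat) set" where
  "unit_perms n = mult_perm n ` {a \<in> residues_mod n. coprime a n}"

lemma unit_perms_permute:
  assumes "p \<in> unit_perms n"
  shows "p permutes residues_mod n"
proof -
  obtain a where a: "coprime a n" and p: "p = mult_perm n a"
    using assms by (auto simp: unit_perms_def)
  have "inj_on p (residues_mod n)"
  proof (rule inj_onI)
    fix x y assume xy: "x \<in> residues_mod n" "y \<in> residues_mod n" "p x = p y"
    hence "[a * x = a * y] (mod n)"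
      by (simp add: p mult_perm_def cong_def)
    hence "[x = y] (mod n)"
      using a by (simp add: cong_mult_lcancel_nat)
    thus "x = y"
      using xy by (simp add: residues_mod_def cong_less_modulus_unique_nat)
  qed
  moreover have "p ` residues_mod n \<subseteq> residues_mod n"
    by (auto simp: p mult_perm_def residues_mod_def)
  ultimately have "bij_betw p (residues_mod n) (residues_mod n)"
    by (simp add: bij_betw_def endo_inj_surj residues_mod_def)
  thus ?thesis
    by (rule bij_imp_permutes) (simp add: p mult_perm_def)
qed

end

theory Submission
  imports Defs
begin

text \<open>
  If a permutation \<open>p\<close> has order dividing \<open>q ^ k\<close> with \<open>q\<close> prime, all its cycle lengths are powers
  of \<open>q\<close>, and the points on cycles of length \<open>q ^ j\<close> are those fixed by \<open>p ^ q ^ j\<close> but not by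
  \<open>p ^ q ^ (j - 1)\<close>. So the cycle type is determined by fixed point counts, and multiplication by
  \<open>a ^ 2 ^ j\<close> modulo \<open>2 ^ m\<close> fixes exactly \<open>gcd (a ^ 2 ^ j - 1) (2 ^ m)\<close> residues.

  With \<open>m = k + 2\<close>, the units are \<open>4 c + 1\<close> and \<open>4 c - 1\<close> for \<open>0 < c \<le> 2 ^ k\<close>. Repeated squaring
  shows that both \<open>(4 c + 1) ^ 2 ^ j - 1\<close> (for \<open>j \<ge> 0\<close>) and \<open>(4 c - 1) ^ 2 ^ j - 1\<close> (for \<open>j \<ge> 1\<close>)
  are odd multiples of \<open>2 ^ (j + 2) c\<close>, so the cycle type depends only on the sign and on
  \<open>gcd c (2 ^ k) = 2 ^ r\<close>, which is attained by \<open>totient (2 ^ (k - r))\<close> values of \<open>c\<close>. The sums over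
  \<open>t\<close> in the theorem are the terms \<open>r = k - 1 - t\<close> with \<open>0 < r < k\<close>; the terms \<open>r = k\<close> (the units
  \<open>1\<close> and \<open>-1\<close>) and \<open>r = 0\<close> are the ones listed separately.
\<close>

section \<open>Cycle lengths and fixed points of powers of a permutation\<close>

lemma funpow_eq_self_iff_card_orbit_dvd:
  assumes "x \<in> orbit f x"
  shows "(f ^^ k) x = x \<longleftrightarrow> card (orbit f x) dvd k"
proof -
  \<comment> \<open>The iterates before the first return to \<open>x\<close> are distinct and
    exhaust the orbit, so the return time is its cardinality.\<close>
  define n where "n = funpow_dist1 f x x"
  have n: "n > 0" "(f ^^ n) x = x"
    using funpow_dist1_prop[OF assms] by (simp_all add: n_def del: funpow.simps)
  have least: "(f ^^ l) x \<noteq> x" if "0 < l" "l < n" for l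
    using funpow_dist1_least[of l f x x] that by (simp add: n_def)
  have "orbit f x = (\<lambda>l. (f ^^ l) x) ` {0..<n}"
    using orbit_altdef_bounded[OF n(2,1)] by auto
  moreover have "inj_on (\<lambda>l. (f ^^ l) x) {0..<n}"
    using n(2) least by (rule inj_on_funpow_least)
  ultimately have card: "card (orbit f x) = n"
    by (simp add: card_image)
  have "(f ^^ k) x = (f ^^ (k mod n)) x"
    using n(2) by (simp add: funpow_mod_eq)
  moreover have "k mod n < n"
    using n(1) by simp
  ultimately have "(f ^^ k) x = x \<longleftrightarrow> k mod n = 0"
    using least[of "k mod n"] by (cases "k mod n = 0") auto
  thus ?thesis
    by (simp add: card dvd_eq_mod_eq_0)
qed

lemma card_points_in_cycles:
  assumes "p permutes P" and "finite P"
  shows "card {x \<in> P. card (orbit p x) = i} = i * cycle_count p P i"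
proof -
  let ?C = "{C \<in> orbit p ` P. card C = i}"
  have perm: "permutation p"
    using assms permutation_permutes by blast
  have self: "x \<in> orbit p x" for x
    using perm by (rule permutation_self_in_orbit)
  have eq: "orbit p y = orbit p x" if "y \<in> orbit p x" for x y
    using orbit_cyclic_eq3[OF cyclic_on_orbit'[OF perm] that] .
  have "{x \<in> P. card (orbit p x) = i} = \<Union> ?C"
    using self eq permutes_orbit_subset[OF assms(1)] by fastforce
  moreover have "i * card ?C = card (\<Union> ?C)"
  proof (rule card_partition)
    show "finite ?C" using assms(2) by simp
    show "finite (\<Union> ?C)"
      using assms permutes_orbit_subset[OF assms(1)] by (intro finite_subset[OF _ assms(2)]) auto
    show "C \<inter> D = {}" if "C \<in> ?C" "D \<in> ?C" "C \<noteq> D" for C D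
      using that eq by blast
  qed auto
  ultimately show ?thesis
    by (simp add: cycle_count_def)
qed

text \<open>The sets counted by \<open>F\<close> increase with \<open>j\<close>, so the truncated
  subtraction is exact. The exponent \<open>k\<close> may exceed the minimal one: the surplus
  factors have exponent 0.\<close>

lemma ctype_of_prime_power_order:
  assumes q: "prime q" and p: "p permutes P" and P: "finite P"
    and F: "\<And>j. F j = card {x \<in> P. (p ^^ (q ^ j)) x = x}"
    and order: "F k = card P"
  shows "ctype p P = indet 1 ^ F 0 * (\<Prod>j = 1..k. indet (q ^ j) ^ ((F j - F (j - 1)) div q ^ j))"
proof -
  have q1: "q > 1"
    using q by (rule prime_gt_1_nat)
  have self: "x \<in> orbit p x" for x
    using p P permutation_permutes permutation_self_in_orbit by metis
  have fix_iff: "(p ^^ (q ^ j)) x = x \<longleftrightarrow> (\<exists>l\<le>j. card (orbit p x) = q ^ l)" for j x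
    using q by (simp add: funpow_eq_self_iff_card_orbit_dvd[OF self] divides_primepow_nat)
  have order: "(p ^^ (q ^ k)) x = x" if "x \<in> P" for x
  proof -
    have "{x \<in> P. (p ^^ (q ^ k)) x = x} = P"
      using P order F[of k] by (intro card_subset_eq) auto
    thus ?thesis using that by blast
  qed
  have one: "cycle_count p P 1 = F 0"
    using card_points_in_cycles[OF p P, of 1] fix_iff[of 0] by (simp add: F)
  have step: "cycle_count p P (q ^ j) = (F j - F (j - 1)) div q ^ j" if "j \<ge> 1" for j
  proof -
    have "{x \<in> P. card (orbit p x) = q ^ j} =
        {x \<in> P. (p ^^ (q ^ j)) x = x} - {x \<in> P. (p ^^ (q ^ (j - 1))) x = x}"
      using that q1 by (auto simp: fix_iff)
    moreover have "{x \<in> P. (p ^^ (q ^ (j - 1))) x = x} \<subseteq> {x \<in> P. (p ^^ (q ^ j)) x = x}"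
      using that by (auto simp: fix_iff intro: le_trans[OF _ diff_le_self])
    ultimately have "q ^ j * cycle_count p P (q ^ j) = F j - F (j - 1)"
      using P by (simp add: F card_Diff_subset flip: card_points_in_cycles[OF p P])
    thus ?thesis
      using q1 nonzero_mult_div_cancel_left[of "q ^ j" "cycle_count p P (q ^ j)"] by simp
  qed
  have zero: "cycle_count p P i = 0" if "i \<notin> {1..card P} \<inter> (\<lambda>j. q ^ j) ` {0..k}" for i
  proof -
    have "\<not> card (orbit p x) = i" if "x \<in> P" for x
    proof -
      have "card (orbit p x) \<in> {1..card P}"
        using that self[of x] permutes_orbit_subset[OF p that] P
        by (auto simp: Suc_le_eq card_gt_0_iff intro: card_mono finite_subset)
      moreover have "card (orbit p x) \<in> (\<lambda>j. q ^ j) ` {0..k}"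
        using order[OF that] fix_iff by auto
      ultimately show ?thesis
        using \<open>i \<notin> _\<close> by auto
    qed
    hence none: "{C \<in> orbit p ` P. card C = i} = {}"
      by blast
    show ?thesis
      unfolding cycle_count_def none by simp
  qed
  hence trivial: "indet i ^ cycle_count p P i = 1" if "i \<notin> {1..card P} \<inter> (\<lambda>j. q ^ j) ` {0..k}" for i
    using that by simp
  \<comment> \<open>Some \<open>q ^ j\<close> with \<open>j \<le> k\<close> may exceed
    \<open>card P\<close>, so both index sets are compared through their intersection.\<close>
  have "ctype p P = (\<Prod>i \<in> {1..card P} \<inter> (\<lambda>j. q ^ j) ` {0..k}. indet i ^ cycle_count p P i)"
    unfolding ctype_def by (rule prod.mono_neutral_right) (blast intro: trivial finite_atLeastAtMost)+
  also have "\<dots> = (\<Prod>i \<in> (\<lambda>j. q ^ j) ` {0..k}. indet i ^ cycle_count p P i)"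
    by (rule prod.mono_neutral_left) (blast intro: trivial finite_atLeastAtMost)+
  also have "\<dots> = (\<Prod>j = 0..k. indet (q ^ j) ^ cycle_count p P (q ^ j))"
    using q1 by (subst prod.reindex) (auto simp: inj_on_def power_inject_exp)
  also have "\<dots> = indet 1 ^ F 0 * (\<Prod>j = 1..k. indet (q ^ j) ^ cycle_count p P (q ^ j))"
    using one by (simp add: prod.atLeast_Suc_atMost)
  finally show ?thesis
    using step by simp
qed

section \<open>Fixed points of multiplication modulo n\<close>

lemma card_annihilator_mod:
  fixes c n :: nat
  assumes "n > 0"
  shows "card {x \<in> {0..<n}. n dvd c * x} = gcd c n"
proof -
  define g where "g = gcd c n"
  have g: "g > 0" using assms by (simp add: g_def)
  obtain c' n' where cn: "c = g * c'" "n = g * n'" "coprime c' n'"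
    unfolding g_def using gcd_coprime_exists[of c n] assms by (metis gcd_pos_nat less_irrefl mult.commute)
  have n': "n' > 0" using assms cn by auto
  \<comment> \<open>After cancelling \<open>g\<close>, coprimality removes \<open>c'\<close>; what
    remains are the \<open>g\<close> multiples of \<open>n'\<close> below
    \<open>g * n'\<close>.\<close>
  have "n dvd c * x \<longleftrightarrow> n' dvd x" for x
    using g cn by (simp add: mult.assoc coprime_commute coprime_dvd_mult_right_iff)
  moreover have "{x \<in> {0..<g * n'}. n' dvd x} = (\<lambda>y. n' * y) ` {0..<g}"
    using n' by (auto simp: mult.commute elim!: dvdE)
  moreover have "card ((\<lambda>y. n' * y) ` {0..<g}) = g"
    using n' by (subst card_image) (auto simp: inj_on_def)
  ultimately show ?thesis
    by (simp add: cn(2)[symmetric] g_def[symmetric])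
qed

lemma mult_perm_funpow:
  "x < n \<Longrightarrow> (mult_perm n a ^^ k) x = a ^ k * x mod n"
  by (induction k) (auto simp: mult_perm_def residues_mod_def mod_mult_right_eq mult.assoc)

lemma card_fixed_points_mult_perm:
  assumes "n > 0" and "a ^ k = 1 + d"
  shows "card {x \<in> residues_mod n. (mult_perm n a ^^ k) x = x} = gcd d n"
proof -
  have "(1 + d) * x mod n = x \<longleftrightarrow> n dvd d * x" if "x < n" for x
  proof -
    have "(1 + d) * x mod n = x \<longleftrightarrow> [x + d * x = x + 0] (mod n)"
      using that by (simp add: cong_def)
    also have "\<dots> \<longleftrightarrow> n dvd d * x"
      by (simp only: cong_add_lcancel_nat cong_0_iff)
    finally show ?thesis .
  qed
  hence "{x \<in> residues_mod n. (mult_perm n a ^^ k) x = x} = {x \<in> {0..<n}. n dvd d * x}"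
    using assms(2) by (auto simp: residues_mod_def mult_perm_funpow)
  thus ?thesis
    using card_annihilator_mod[OF assms(1)] by simp
qed

text \<open>Multipliers outside the residue range are needed later: \<open>4 * c + 1\<close> exceeds
  the modulus \<open>2 ^ (k + 2)\<close> when \<open>c = 2 ^ k\<close>.\<close>

lemma mult_perm_mod: "mult_perm n (a mod n) = mult_perm n a"
  by (auto simp: mult_perm_def fun_eq_iff mod_mult_left_eq)

lemma mult_perm_permutes:
  assumes "n > 0" and "coprime a n"
  shows "mult_perm n a permutes residues_mod n"
proof (rule unit_perms_permute)
  have "a mod n \<in> {a \<in> residues_mod n. coprime a n}"
    using assms by (simp add: residues_mod_def)
  thus "mult_perm n a \<in> unit_perms n"
    unfolding unit_perms_def by (metis (lifting) image_eqI mult_perm_mod)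
qed

section \<open>Enumeration of the units modulo a power of two\<close>

lemma sum_unit_perms:
  assumes "n > 1"
  shows "(\<Sum>p\<in>unit_perms n. f p) = (\<Sum>a | a < n \<and> coprime a n. f (mult_perm n a))"
    and "card (unit_perms n) = card {a. a < n \<and> coprime a n}"
proof -
  let ?U = "{a \<in> residues_mod n. coprime a n}"
  have "inj_on (mult_perm n) ?U"
  proof (rule inj_onI)
    fix a b assume "a \<in> ?U" "b \<in> ?U" "mult_perm n a = mult_perm n b"
    \<comment> \<open>Evaluation at 1, a residue because \<open>n > 1\<close>, recovers the
      multiplier.\<close>
    hence "mult_perm n a 1 = mult_perm n b 1" "a < n" "b < n"
      by (simp_all add: residues_mod_def)
    thus "a = b"
      using assms by (simp add: mult_perm_def residues_mod_def)
  qed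
  moreover have "?U = {a. a < n \<and> coprime a n}"
    by (auto simp: residues_mod_def)
  ultimately show "(\<Sum>p\<in>unit_perms n. f p) = (\<Sum>a | a < n \<and> coprime a n. f (mult_perm n a))"
    and "card (unit_perms n) = card {a. a < n \<and> coprime a n}"
    unfolding unit_perms_def by (simp_all add: sum.reindex card_image)
qed

lemma sum_residues_1_mod_4: "(\<Sum>a | a < 4 * N \<and> a mod 4 = 1. f a) = (\<Sum>c<N. f (4 * c + 1))" for N :: nat
proof (rule sum.reindex_bij_witness[of _ "\<lambda>c. 4 * c + 1" "\<lambda>a. a div 4"])
  fix a assume "a \<in> {a. a < 4 * N \<and> a mod 4 = 1}"
  moreover from this show a: "4 * (a div 4) + 1 = a"
    using mult_div_mod_eq[of 4 a] by simp
  ultimately show "a div 4 \<in> {..<N}" by auto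
  show "f (4 * (a div 4) + 1) = f a" by (simp only: a)
next
  fix c assume "c \<in> {..<N}"
  thus "4 * c + 1 \<in> {a. a < 4 * N \<and> a mod 4 = 1}" by (auto simp: mod_Suc)
  show "(4 * c + 1) div 4 = c" by simp
qed

text \<open>With \<open>4 * c - 1\<close> instead of \<open>4 * c + 3\<close>, the divisibility of
  \<open>c\<close> by powers of two governs the cycle type just as for
  \<open>4 * c + 1\<close>.\<close>

lemma sum_residues_3_mod_4:
  "(\<Sum>a | a < 4 * N \<and> a mod 4 = 3. f a) = (\<Sum>c\<in>{0<..N}. f (4 * c - 1))" for N :: nat
proof (rule sum.reindex_bij_witness[of _ "\<lambda>c. 4 * c - 1" "\<lambda>a. a div 4 + 1"])
  fix a assume "a \<in> {a. a < 4 * N \<and> a mod 4 = 3}"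
  moreover from this show a: "4 * (a div 4 + 1) - 1 = a"
    using mult_div_mod_eq[of 4 a] by simp
  ultimately show "a div 4 + 1 \<in> {0<..N}" by auto
  show "f (4 * (a div 4 + 1) - 1) = f a" by (simp only: a)
next
  fix c assume c: "c \<in> {0<..N}"
  then obtain b where b: "c = Suc b" by (cases c) auto
  have eq: "4 * c - 1 = 4 * b + 3" by (simp add: b)
  have "b < N" using c b by simp
  thus "4 * c - 1 \<in> {a. a < 4 * N \<and> a mod 4 = 3}" unfolding eq by simp
  show "(4 * c - 1) div 4 + 1 = c" unfolding eq by (simp add: b)
qed

lemma sum_unit_perms_two_power:
  "(\<Sum>p\<in>unit_perms (2 ^ (k + 2)). f p) =
     (\<Sum>c\<in>{0<..2 ^ k}. f (mult_perm (2 ^ (k + 2)) (4 * c + 1)) + f (mult_perm (2 ^ (k + 2)) (4 * c - 1)))"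
proof -
  let ?n = "2 ^ (k + 2) :: nat" and ?g = "\<lambda>a. f (mult_perm (2 ^ (k + 2)) a)"
  have n1: "?n > 1" by (rule one_less_power) auto
  have n4: "?n = 4 * 2 ^ k" by simp
  have odd_iff: "coprime a ?n \<longleftrightarrow> odd a" for a :: nat
    by (simp only: coprime_power_right_iff coprime_right_2_iff_odd) simp
  have "(\<Sum>p\<in>unit_perms ?n. f p) = (\<Sum>a | a < ?n \<and> odd a. ?g a)"
    unfolding sum_unit_perms(1)[OF n1] odd_iff ..
  also have "{a. a < ?n \<and> odd a} = {a. a < ?n \<and> a mod 4 = 1} \<union> {a. a < ?n \<and> a mod 4 = 3}"
  proof -
    have "odd a \<longleftrightarrow> a mod 4 = 1 \<or> a mod 4 = 3" for a :: nat by presburger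
    thus ?thesis by blast
  qed
  also have "(\<Sum>a\<in>\<dots>. ?g a) = (\<Sum>a | a < ?n \<and> a mod 4 = 1. ?g a) + (\<Sum>a | a < ?n \<and> a mod 4 = 3. ?g a)"
    by (rule sum.union_disjoint) auto
  also have "(\<Sum>a | a < ?n \<and> a mod 4 = 3. ?g a) = (\<Sum>c\<in>{0<..2 ^ k}. ?g (4 * c - 1))"
    unfolding n4 by (rule sum_residues_3_mod_4)
  also have "(\<Sum>a | a < ?n \<and> a mod 4 = 1. ?g a) = (\<Sum>c<2 ^ k. ?g (4 * c + 1))"
    unfolding n4 by (rule sum_residues_1_mod_4)
  also have "\<dots> = (\<Sum>c\<in>{0<..2 ^ k}. ?g (4 * c + 1))"
  proof -
    \<comment> \<open>The unit \<open>1\<close> is moved from \<open>c = 0\<close> to \<open>c = 2 ^ k\<close>, so that both signs share one index set.\<close>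
    have "(4 * 2 ^ k + 1) mod ?n = (4 * 0 + 1) mod ?n"
      by (simp only: n4 mod_add_self1 mult_0_right add_0)
    hence "mult_perm ?n (4 * 2 ^ k + 1) = mult_perm ?n (4 * 0 + 1)"
      by (metis mult_perm_mod)
    moreover have "{..<2 ^ k} = insert 0 {0<..<2 ^ k :: nat}" "{0<..2 ^ k} = insert (2 ^ k) {0<..<2 ^ k :: nat}"
      by auto
    ultimately show ?thesis by simp
  qed
  finally show ?thesis
    by (simp only: sum.distrib)
qed

lemma card_unit_perms_two_power: "card (unit_perms (2 ^ (k + 2))) = 2 ^ (k + 1)"
  using sum_unit_perms_two_power[of "\<lambda>_. 1 :: nat" k] by simp

text \<open>Division by \<open>q ^ r\<close> maps the class with gcd \<open>q ^ r\<close> onto the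
  numbers up to \<open>q ^ (k - r)\<close> coprime to it, whence the totient.\<close>

lemma sum_over_gcd_prime_power:
  fixes f :: "nat \<Rightarrow> 'a :: comm_semiring_1"
  assumes "prime q"
  shows "(\<Sum>c\<in>{0<..q ^ k}. f (gcd c (q ^ k))) = (\<Sum>r\<le>k. of_nat (totient (q ^ (k - r))) * f (q ^ r))"
proof -
  let ?S = "{0<..q ^ k}" and ?T = "(\<lambda>r. q ^ r) ` {..k}"
  have q: "q > 1" using assms by (rule prime_gt_1_nat)
  have "(\<lambda>c. gcd c (q ^ k)) ` ?S \<subseteq> ?T"
  proof
    fix d assume "d \<in> (\<lambda>c. gcd c (q ^ k)) ` ?S"
    hence "d dvd q ^ k" by auto
    thus "d \<in> ?T" using assms by (auto simp: divides_primepow_nat)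
  qed
  hence "(\<Sum>c\<in>?S. f (gcd c (q ^ k))) = (\<Sum>d\<in>?T. \<Sum>c | c \<in> ?S \<and> gcd c (q ^ k) = d. f (gcd c (q ^ k)))"
    by (intro sum.group[symmetric]) auto
  also have "\<dots> = (\<Sum>d\<in>?T. of_nat (card {c \<in> ?S. gcd c (q ^ k) = d}) * f d)"
    by (intro sum.cong refl) simp
  also have "\<dots> = (\<Sum>d\<in>?T. of_nat (totient (q ^ k div d)) * f d)"
    using q by (intro sum.cong refl)
      (auto simp: card_gcd_eq_totient le_imp_power_dvd simp del: greaterThanAtMost_iff)
  also have "\<dots> = (\<Sum>r\<le>k. of_nat (totient (q ^ k div q ^ r)) * f (q ^ r))"
    using q by (subst sum.reindex) (auto simp: inj_on_def)
  also have "\<dots> = (\<Sum>r\<le>k. of_nat (totient (q ^ (k - r))) * f (q ^ r))"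
    using q by (intro sum.cong refl) (simp add: power_diff)
  finally show ?thesis .
qed

section \<open>Repeated squaring and powers of two\<close>

lemma power_two_power_1_mod_4:
  fixes c :: nat
  obtains e where "odd e" "(4 * c + 1) ^ 2 ^ j = 1 + 2 ^ j * (4 * (c * e))"
proof -
  have "\<exists>e. odd e \<and> (4 * c + 1) ^ 2 ^ j = 1 + 2 ^ j * (4 * (c * e))"
  proof (induction j)
    case 0
    show ?case by (rule exI[of _ 1]) simp
  next
    case (Suc j)
    then obtain e where e: "odd e" "(4 * c + 1) ^ 2 ^ j = 1 + 2 ^ j * (4 * (c * e))" by blast
    have "(4 * c + 1) ^ 2 ^ Suc j = ((4 * c + 1) ^ 2 ^ j) ^ 2"
      by (simp add: power_mult[symmetric] mult.commute)
    \<comment> \<open>The square of \<open>1 + u\<close> is \<open>1 + 2 * u * (1 + u / 2)\<close>;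
      here 4 divides \<open>u\<close>, so the new cofactor stays odd.\<close>
    also have "\<dots> = 1 + 2 ^ Suc j * (4 * (c * (e * (1 + 2 ^ j * (2 * (c * e))))))"
      unfolding e(2) by (simp add: power2_eq_square algebra_simps)
    finally show ?case
      using e(1) by (intro exI[of _ "e * (1 + 2 ^ j * (2 * (c * e)))"]) simp
  qed
  thus thesis using that by blast
qed

text \<open>One squaring reduces to the residue 1 modulo 4, with \<open>2 * c * (2 * c - 1)\<close>
  in the role of \<open>c\<close>. The factor 2 accounts for the shift from \<open>j\<close> to
  \<open>Suc j\<close>, and the odd factor is absorbed into \<open>e\<close>.\<close>

lemma power_two_power_3_mod_4:
  fixes c :: nat
  assumes "c > 0"
  obtains e where "odd e" "(4 * c - 1) ^ 2 ^ Suc j = 1 + 2 ^ Suc j * (4 * (c * e))"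
proof -
  obtain b where b: "c = Suc b" using assms by (cases c) auto
  obtain e where e: "odd e"
    "(4 * (2 * c * (2 * c - 1)) + 1) ^ 2 ^ j = 1 + 2 ^ j * (4 * (2 * c * (2 * c - 1) * e))"
    by (rule power_two_power_1_mod_4)
  have "(4 * c - 1) ^ 2 ^ Suc j = ((4 * c - 1) ^ 2) ^ 2 ^ j"
    by (simp add: power_mult)
  also have "(4 * c - 1) ^ 2 = 4 * (2 * c * (2 * c - 1)) + 1"
    unfolding b by (simp add: power2_eq_square algebra_simps)
  finally show thesis
    using e assms by (intro that[of "(2 * c - 1) * e"]) (auto simp: algebra_simps)
qed

lemma odd_imp_coprime_two_power: "odd a \<Longrightarrow> coprime a (2 ^ k)" for a :: nat
  by (simp only: coprime_power_right_iff coprime_right_2_iff_odd simp_thms)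

lemma gcd_two_power_shift:
  fixes c e :: nat
  assumes r: "gcd c (2 ^ k) = 2 ^ r" and e: "odd e"
  shows "gcd (2 ^ j * (4 * (c * e))) (2 ^ (k + 2)) = 2 ^ min (k + 2) (j + r + 2)"
proof -
  have "gcd (2 ^ j * (4 * (c * e))) (2 ^ (k + 2)) = gcd (e * (4 * (2 ^ j * c))) (2 ^ (k + 2))"
    by (simp add: ac_simps)
  also have "\<dots> = gcd (4 * (2 ^ j * c)) (4 * 2 ^ k)"
    using odd_imp_coprime_two_power[OF e, of "k + 2"]
    by (subst gcd_mult_left_left_cancel) (simp_all add: power_add mult.commute coprime_commute)
  also have "\<dots> = 4 * gcd (2 ^ j * c) (2 ^ k)"
    by (simp only: gcd_mult_distrib_nat[symmetric])
  \<comment> \<open>Inserting a multiple of \<open>2 ^ k\<close> changes nothing, but lets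
    \<open>2 ^ j\<close> be factored out so that \<open>r\<close> applies.\<close>
  also have "gcd (2 ^ j * c) (2 ^ k) = gcd (gcd (2 ^ j * c) (2 ^ j * 2 ^ k)) (2 ^ k)"
    by (simp add: gcd.assoc gcd_proj2_if_dvd_nat)
  also have "gcd (2 ^ j * c) (2 ^ j * 2 ^ k) = 2 ^ (j + r)"
    by (simp only: gcd_mult_distrib_nat[symmetric] r power_add)
  also have "gcd (2 ^ (j + r)) (2 ^ k) = (2 ^ min k (j + r) :: nat)"
    by (cases "j + r \<le> k") (auto simp: min_def gcd_proj1_if_dvd_nat gcd_proj2_if_dvd_nat le_imp_power_dvd)
  also have "4 * 2 ^ min k (j + r) = (2 ^ min (k + 2) (j + r + 2) :: nat)"
    by (simp add: min_add_distrib_left[symmetric] power_add)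
  finally show ?thesis .
qed

text \<open>This is the exponent of the indeterminate with index \<open>2 ^ j\<close>. Once
  \<open>j + r > k\<close>, both minima equal \<open>k + 2\<close> and the difference
  vanishes.\<close>

lemma two_power_min_difference_div:
  assumes "1 \<le> j"
  shows "(2 ^ min (k + 2) (j + r + 2) - 2 ^ min (k + 2) (j - 1 + r + 2)) div 2 ^ j =
    (if j + r \<le> k then 2 ^ (r + 1) else 0 :: nat)"
proof (cases "j + r \<le> k")
  case True
  have "2 ^ (j + r + 2) - 2 ^ (j - 1 + r + 2) = (2 ^ j * 2 ^ (r + 1) :: nat)"
    using assms by (cases j) (auto simp: power_add)
  with True assms show ?thesis by (simp add: min_def)
next
  case False
  with assms show ?thesis by (simp add: min_def)
qed

lemma prod_two_power_truncate:
  fixes x :: "nat \<Rightarrow> 'a :: comm_monoid_mult" and d :: nat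
  assumes "r \<le> k"
  shows "(\<Prod>j = d..k + 2. x j ^ (if j + r \<le> k then h else 0)) = (\<Prod>j = d..k - r. x j ^ h)"
  using assms by (intro prod.mono_neutral_cong_right) auto

lemma gcd_two_power_exponent_le:
  "gcd c (2 ^ k) = (2 ^ r :: nat) \<Longrightarrow> r \<le> k"
  by (metis gcd_dvd2 one_less_numeral_iff power_dvd_imp_le semiring_norm(76))

section \<open>Cycle types of the individual units\<close>

lemma ctype_mult_perm_1_mod_4:
  assumes r: "gcd c (2 ^ k) = 2 ^ r"
  shows "ctype (mult_perm (2 ^ (k + 2)) (4 * c + 1)) (residues_mod (2 ^ (k + 2))) =
    indet 1 ^ 2 ^ (r + 2) * (\<Prod>j = 1..k - r. indet (2 ^ j) ^ 2 ^ (r + 1))"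
proof -
  let ?n = "2 ^ (k + 2) :: nat" and ?a = "4 * c + 1"
  define F where "F j = card {x \<in> residues_mod ?n. (mult_perm ?n ?a ^^ (2 ^ j)) x = x}" for j
  have F: "F j = 2 ^ min (k + 2) (j + r + 2)" for j
  proof -
    obtain e where e: "odd e" "?a ^ 2 ^ j = 1 + 2 ^ j * (4 * (c * e))"
      by (rule power_two_power_1_mod_4)
    have "F j = gcd (2 ^ j * (4 * (c * e))) ?n"
      unfolding F_def by (rule card_fixed_points_mult_perm[OF _ e(2)]) simp
    thus ?thesis
      by (simp only: gcd_two_power_shift[OF r e(1)])
  qed
  have le: "r \<le> k"
    using r by (rule gcd_two_power_exponent_le)
  have "ctype (mult_perm ?n ?a) (residues_mod ?n) =
    indet 1 ^ F 0 * (\<Prod>j = 1..k + 2. indet (2 ^ j) ^ ((F j - F (j - 1)) div 2 ^ j))"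
  proof (rule ctype_of_prime_power_order)
    show "mult_perm ?n ?a permutes residues_mod ?n"
      by (intro mult_perm_permutes odd_imp_coprime_two_power) auto
    show "F (k + 2) = card (residues_mod ?n)"
      by (simp add: F residues_mod_def)
  qed (auto simp: residues_mod_def F_def)
  also have "(\<Prod>j = 1..k + 2. indet (2 ^ j) ^ ((F j - F (j - 1)) div 2 ^ j)) =
      (\<Prod>j = 1..k + 2. indet (2 ^ j) ^ (if j + r \<le> k then 2 ^ (r + 1) else 0))"
    by (intro prod.cong refl) (simp only: F two_power_min_difference_div atLeastAtMost_iff)
  also have "F 0 = 2 ^ (r + 2)"
    using le by (simp add: F)
  finally show ?thesis
    unfolding prod_two_power_truncate[OF le] .
qed

text \<open>The fixed point formula fails at \<open>j = 0\<close>: since \<open>4 * c - 2\<close> is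
  twice an odd number, only two residues are fixed. Hence the factor for \<open>j = 1\<close> is
  split off.\<close>

lemma ctype_mult_perm_3_mod_4:
  assumes r: "gcd c (2 ^ k) = 2 ^ r" and c: "c > 0"
  shows "ctype (mult_perm (2 ^ (k + 2)) (4 * c - 1)) (residues_mod (2 ^ (k + 2))) =
    indet 1 ^ 2 * indet 2 ^ (2 ^ min (k + 1) (r + 2) - 1) *
      (\<Prod>j = 2..k - r. indet (2 ^ j) ^ 2 ^ (r + 1))"
proof -
  let ?n = "2 ^ (k + 2) :: nat" and ?a = "4 * c - 1"
  define F where "F j = card {x \<in> residues_mod ?n. (mult_perm ?n ?a ^^ (2 ^ j)) x = x}" for j
  have F: "F j = 2 ^ min (k + 2) (j + r + 2)" if j: "j \<ge> 1" for j
  proof -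
    obtain i where i: "j = Suc i" using j by (cases j) auto
    obtain e where e: "odd e" "?a ^ 2 ^ j = 1 + 2 ^ j * (4 * (c * e))"
      unfolding i using c by (rule power_two_power_3_mod_4)
    have "F j = gcd (2 ^ j * (4 * (c * e))) ?n"
      unfolding F_def by (rule card_fixed_points_mult_perm[OF _ e(2)]) simp
    thus ?thesis
      by (simp only: gcd_two_power_shift[OF r e(1)])
  qed
  have F0: "F 0 = 2"
  proof -
    have "F 0 = gcd (2 * (2 * c - 1)) ?n"
      unfolding F_def using c by (intro card_fixed_points_mult_perm) auto
    also have "\<dots> = 2 * gcd (2 * c - 1) (2 ^ (k + 1))"
      by (simp add: gcd_mult_distrib_nat)
    also have "gcd (2 * c - 1) (2 ^ (k + 1)) = 1"
      using c by (intro coprime_imp_gcd_eq_1 odd_imp_coprime_two_power) auto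
    finally show ?thesis by simp
  qed
  have le: "r \<le> k"
    using r by (rule gcd_two_power_exponent_le)
  have "ctype (mult_perm ?n ?a) (residues_mod ?n) =
    indet 1 ^ F 0 * (\<Prod>j = 1..k + 2. indet (2 ^ j) ^ ((F j - F (j - 1)) div 2 ^ j))"
  proof (rule ctype_of_prime_power_order)
    show "mult_perm ?n ?a permutes residues_mod ?n"
      using c by (intro mult_perm_permutes odd_imp_coprime_two_power) auto
    show "F (k + 2) = card (residues_mod ?n)"
      by (simp add: F residues_mod_def)
  qed (auto simp: residues_mod_def F_def)
  also have "(\<Prod>j = 1..k + 2. indet (2 ^ j) ^ ((F j - F (j - 1)) div 2 ^ j)) =
      indet 2 ^ ((F 1 - F 0) div 2) * (\<Prod>j = 2..k + 2. indet (2 ^ j) ^ ((F j - F (j - 1)) div 2 ^ j))"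
    by (simp add: prod.atLeast_Suc_atMost numeral_2_eq_2)
  also have "(\<Prod>j = 2..k + 2. indet (2 ^ j) ^ ((F j - F (j - 1)) div 2 ^ j)) =
      (\<Prod>j = 2..k + 2. indet (2 ^ j) ^ (if j + r \<le> k then 2 ^ (r + 1) else 0))"
  proof (intro prod.cong refl)
    fix j assume "j \<in> {2..k + 2}"
    hence "1 \<le> j" "1 \<le> j - 1" by auto
    thus "indet (2 ^ j) ^ ((F j - F (j - 1)) div 2 ^ j) =
        indet (2 ^ j) ^ (if j + r \<le> k then 2 ^ (r + 1) else 0)"
      by (simp only: F two_power_min_difference_div)
  qed
  \<comment> \<open>The cap \<open>k + 1\<close> matters only for \<open>r = k\<close>, where the
    unit is -1 and its square is the identity.\<close>
  also have "(F 1 - F 0) div 2 = 2 ^ min (k + 1) (r + 2) - 1"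
  proof -
    have "min (k + 2) (1 + r + 2) = Suc (min (k + 1) (r + 2))" by simp
    hence "F 1 - F 0 = 2 * (2 ^ min (k + 1) (r + 2) - 1)"
      by (simp only: F F0 order_refl power_Suc diff_mult_distrib2 mult_1_right)
    thus ?thesis by simp
  qed
  finally show ?thesis
    unfolding prod_two_power_truncate[OF le] F0 by (simp only: mult.assoc)
qed

section \<open>Assembling the cycle index\<close>

lemma cycle_index_unit_perms_two_power:
  "cycle_index (unit_perms (2 ^ (k + 2))) (residues_mod (2 ^ (k + 2))) =
    const_poly (1 / 2 ^ (k + 1)) * (\<Sum>r\<le>k. of_nat (totient (2 ^ (k - r))) *
      (indet 1 ^ 2 ^ (r + 2) * (\<Prod>j = 1..k - r. indet (2 ^ j) ^ 2 ^ (r + 1)) +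
       indet 1 ^ 2 * indet 2 ^ (2 ^ min (k + 1) (r + 2) - 1) *
         (\<Prod>j = 2..k - r. indet (2 ^ j) ^ 2 ^ (r + 1))))"
proof -
  define h where "h r = indet 1 ^ 2 ^ (r + 2) * (\<Prod>j = 1..k - r. indet (2 ^ j) ^ 2 ^ (r + 1)) +
       indet 1 ^ 2 * indet 2 ^ (2 ^ min (k + 1) (r + 2) - 1) *
         (\<Prod>j = 2..k - r. indet (2 ^ j) ^ 2 ^ (r + 1))" for r
  \<comment> \<open>The grouping lemma expects a function of the gcd itself, so \<open>r\<close> is
    recovered from \<open>2 ^ r\<close>.\<close>
  define f where "f d = h (THE r. d = 2 ^ r)" for d :: nat
  have f: "f (2 ^ r) = h r" for r
    by (simp add: f_def)
  have "(\<Sum>p\<in>unit_perms (2 ^ (k + 2)). ctype p (residues_mod (2 ^ (k + 2)))) =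
      (\<Sum>c\<in>{0<..2 ^ k}. f (gcd c (2 ^ k)))"
    unfolding sum_unit_perms_two_power
  proof (intro sum.cong refl)
    fix c :: nat assume "c \<in> {0<..2 ^ k}"
    hence c: "c > 0" by simp
    obtain r where r: "gcd c (2 ^ k) = 2 ^ r"
      using divides_primepow_nat[of 2 "gcd c (2 ^ k)" k] by auto
    show "ctype (mult_perm (2 ^ (k + 2)) (4 * c + 1)) (residues_mod (2 ^ (k + 2))) +
        ctype (mult_perm (2 ^ (k + 2)) (4 * c - 1)) (residues_mod (2 ^ (k + 2))) = f (gcd c (2 ^ k))"
      by (simp only: r f h_def ctype_mult_perm_1_mod_4[OF r] ctype_mult_perm_3_mod_4[OF r c])
  qed
  also have "\<dots> = (\<Sum>r\<le>k. of_nat (totient (2 ^ (k - r))) * h r)"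
    using sum_over_gcd_prime_power[of 2 f k] by (simp add: f)
  finally show ?thesis
    unfolding cycle_index_def card_unit_perms_two_power h_def by simp
qed

text \<open>The modulus 2 is not of the form \<open>2 ^ (k + 2)\<close>; its only unit acts as the
  identity.\<close>

lemma cycle_index_unit_perms_2: "cycle_index (unit_perms 2) (residues_mod 2) = indet 1 ^ 2"
proof -
  have units: "{a. a < 2 \<and> coprime a 2} = {1 :: nat}"
    by (auto simp: less_2_cases_iff)
  have id: "mult_perm 2 1 = id"
    by (auto simp: mult_perm_def residues_mod_def fun_eq_iff)
  have "card (unit_perms 2) = 1"
    using sum_unit_perms(2)[of 2] unfolding units by simp
  moreover have "(\<Sum>p\<in>unit_perms 2. ctype p (residues_mod 2)) = ctype id (residues_mod 2)"
    using sum_unit_perms(1)[of 2 "\<lambda>p. ctype p (residues_mod 2)"] id unfolding units by simp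
  moreover have "ctype id (residues_mod 2) = indet 1 ^ 2"
    using ctype_of_prime_power_order[of 2 id "residues_mod 2" "\<lambda>_. 2" 0]
    by (simp add: permutes_id residues_mod_def)
  ultimately show ?thesis
    by (simp add: cycle_index_def const_poly_def)
qed

lemma sum_atMost_Suc_ends:
  fixes f :: "nat \<Rightarrow> 'a :: comm_monoid_add"
  shows "(\<Sum>r\<le>Suc l. f r) = f (Suc l) + f 0 + (\<Sum>t<l. f (l - t))"
proof -
  have "{..Suc l} = insert (Suc l) (insert 0 {1..l})" by auto
  hence "(\<Sum>r\<le>Suc l. f r) = f (Suc l) + (f 0 + (\<Sum>r = 1..l. f r))" by simp
  also have "(\<Sum>r = 1..l. f r) = (\<Sum>t<l. f (l - t))"
    by (rule sum.reindex_bij_witness[of _ "\<lambda>t. l - t" "\<lambda>r. l - r"]) auto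
  finally show ?thesis by (simp add: add.assoc)
qed

(* In the first term of Z2 the source prints the exponent 2^m - 2 for x_2. That is a misprint:
   the cycle index is homogeneous of degree 2^m when x_i has weight i, which forces 2^(m-1) - 1. *)
theorem lemma4p4:
  fixes m :: nat
  assumes "m \<ge> 1"
  shows
    "let Z = cycle_index (unit_perms (2 ^ m)) (residues_mod (2 ^ m));
         x = indet
     in (m = 1 \<longrightarrow> Z = x 1 ^ 2) \<and>
        (m = 2 \<longrightarrow> Z = const_poly (1 / 2) * (x 1 ^ 4 + x 1 ^ 2 * x 2)) \<and>
        (m \<ge> 3 \<longrightarrow>
          (let Z1 = x 1 ^ (2 ^ m)
                    + 2 ^ (m - 3) * x 1 ^ 2 * x 2 * (\<Prod>l = 3..m. x (2 ^ (l - 2)) ^ 2)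
                    + (\<Sum>t | t + 4 \<le> m. 2 ^ t * x 1 ^ (2 ^ (m - 1 - t))
                         * (\<Prod>i = 0..t. x (2 ^ (i + 1)) ^ (2 ^ (m - 2 - t))));
               Z2 = x 1 ^ 2 * x 2 ^ (2 ^ (m - 1) - 1)
                    + 2 ^ (m - 3) * x 1 ^ 4 * (\<Prod>l = 3..m. x (2 ^ (l - 2)) ^ 2)
                    + x 1 ^ 2 * (\<Sum>t | t + 4 \<le> m. 2 ^ t * x 2 ^ (2 ^ (m - t - 1) - 1)
                         * (\<Prod>i = 1..t. x (2 ^ (i + 1)) ^ (2 ^ (m - t - 2))))
           in Z = const_poly (1 / 2 ^ (m - 1)) * (Z1 + Z2)))"
proof -
  consider "m = 1" | k where "m = k + 2"
    using assms by (metis One_nat_def add_2_eq_Suc' le_Suc_ex not0_implies_Suc not_one_le_zero plus_1_eq_Suc)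
  thus ?thesis
  proof cases
    case 1
    thus ?thesis
      by (simp add: cycle_index_unit_perms_2)
  next
    case (2 k)
    show ?thesis
    proof (cases k)
      \<comment> \<open>For \<open>k = 0\<close> the end terms \<open>r = 0\<close> and
        \<open>r = k\<close> coincide, so the sum cannot be split at both ends.\<close>
      case 0
      thus ?thesis
        using cycle_index_unit_perms_two_power[of 0] 2 by simp
    next
      case (Suc l)
      define x where "x = indet"
      define h where "h r = of_nat (totient (2 ^ (Suc l - r))) *
        (x 1 ^ 2 ^ (r + 2) * (\<Prod>j = 1..Suc l - r. x (2 ^ j) ^ 2 ^ (r + 1)) +
         x 1 ^ 2 * x 2 ^ (2 ^ min (Suc l + 1) (r + 2) - 1) *
           (\<Prod>j = 2..Suc l - r. x (2 ^ j) ^ 2 ^ (r + 1)))" for r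
      have m: "m = l + 3" using 2 Suc by simp
      have idx: "{t. t + 4 \<le> m} = {..<l}" by (auto simp: m)
      have Z: "cycle_index (unit_perms (2 ^ m)) (residues_mod (2 ^ m)) =
          const_poly (1 / 2 ^ (m - 1)) * (\<Sum>r\<le>Suc l. h r)"
      proof -
        have "m - 1 = Suc l + 1" "m = Suc l + 2" by (simp_all add: m)
        thus ?thesis
          unfolding h_def x_def by (simp only: cycle_index_unit_perms_two_power)
      qed
      have top: "h (Suc l) = x 1 ^ 2 ^ m + x 1 ^ 2 * x 2 ^ (2 ^ (m - 1) - 1)"
        by (simp add: h_def m eval_nat_numeral)
      have prod_eq: "(\<Prod>l = 3..m. x (2 ^ (l - 2)) ^ 2) = (\<Prod>j = 1..Suc l. x (2 ^ j) ^ 2)"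
      proof -
        have "{3..m} = {1 + 2..Suc l + 2}" by (simp add: m)
        thus ?thesis
          by (simp only: prod.shift_bounds_cl_nat_ivl add_diff_cancel_right')
      qed
      \<comment> \<open>The two summands change places here: the one listed in \<open>Z1\<close>
        comes from the units \<open>4 * c - 1\<close>, the one in \<open>Z2\<close> from
        \<open>4 * c + 1\<close>. In the former, \<open>x 2 ^ 3 = x 2 * x 2 ^ 2\<close>, and the
        square completes the product.\<close>
      have bottom: "h 0 = 2 ^ (m - 3) * x 1 ^ 2 * x 2 * (\<Prod>l = 3..m. x (2 ^ (l - 2)) ^ 2) +
          2 ^ (m - 3) * x 1 ^ 4 * (\<Prod>l = 3..m. x (2 ^ (l - 2)) ^ 2)"
      proof -
        have eqs: "(2::nat) ^ (0 + 2) = 4" "(2::nat) ^ (0 + 1) = 2" "min (Suc l + 1) (0 + 2) = 2"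
            "2 ^ 2 - 1 = (3::nat)" "Suc l - 0 = Suc l" "m - 3 = l"
          by (simp_all add: m)
        have tot: "of_nat (totient (2 ^ Suc l)) = (2 ^ l :: cpoly)"
          by (simp add: totient_prime_power_Suc del: power_Suc)
        have split: "(\<Prod>j = 1..Suc l. x (2 ^ j) ^ 2) = x 2 ^ 2 * (\<Prod>j = 2..Suc l. x (2 ^ j) ^ 2)"
          by (subst prod.atLeast_Suc_atMost) (simp, simp only: Suc_1 power_one_right)
        show ?thesis
          unfolding h_def eqs tot prod_eq split
          by (simp only: power2_eq_square power3_eq_cube algebra_simps)
      qed
      \<comment> \<open>With \<open>r = l - t\<close> the class size is
        \<open>totient (2 ^ (t + 1)) = 2 ^ t\<close>, and \<open>r < k\<close> makes the cap in the
        exponent of \<open>x 2\<close> inactive.\<close>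
      have middle: "h (l - t) =
          2 ^ t * x 1 ^ 2 ^ (m - 1 - t) * (\<Prod>i = 0..t. x (2 ^ (i + 1)) ^ 2 ^ (m - 2 - t)) +
          x 1 ^ 2 * (2 ^ t * x 2 ^ (2 ^ (m - t - 1) - 1) *
            (\<Prod>i = 1..t. x (2 ^ (i + 1)) ^ 2 ^ (m - t - 2)))" if "t < l" for t
      proof -
        have eqs: "Suc l - (l - t) = t + 1" "l - t + 2 = m - 1 - t" "l - t + 1 = m - 2 - t"
            "min (Suc l + 1) (m - 1 - t) = m - 1 - t" "m - t - 1 = m - 1 - t" "m - t - 2 = m - 2 - t"
          using that by (auto simp: m)
        have tot: "of_nat (totient (2 ^ (t + 1))) = (2 ^ t :: cpoly)"
          using totient_prime_power_Suc[of 2 t] by simp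
        have p1: "(\<Prod>i = 0..t. x (2 ^ (i + 1)) ^ e) = (\<Prod>j = 1..t + 1. x (2 ^ j) ^ e)"
          and p2: "(\<Prod>i = 1..t. x (2 ^ (i + 1)) ^ e) = (\<Prod>j = 2..t + 1. x (2 ^ j) ^ e)" for e
          using prod.shift_bounds_cl_nat_ivl[of "\<lambda>j. x (2 ^ j) ^ e" 0 1 t]
            prod.shift_bounds_cl_nat_ivl[of "\<lambda>j. x (2 ^ j) ^ e" 1 1 t]
          by (simp_all only: add_0 one_add_one)
        show ?thesis
          unfolding h_def eqs tot p1 p2 by (simp only: algebra_simps)
      qed
      have "m \<noteq> 1" "m \<noteq> 2" by (simp_all add: m)
      moreover have "(\<Sum>t<l. h (l - t)) =
          (\<Sum>t | t + 4 \<le> m. 2 ^ t * x 1 ^ 2 ^ (m - 1 - t) * (\<Prod>i = 0..t. x (2 ^ (i + 1)) ^ 2 ^ (m - 2 - t))) +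
          x 1 ^ 2 * (\<Sum>t | t + 4 \<le> m. 2 ^ t * x 2 ^ (2 ^ (m - t - 1) - 1) *
            (\<Prod>i = 1..t. x (2 ^ (i + 1)) ^ 2 ^ (m - t - 2)))"
        unfolding idx sum_distrib_left sum.distrib[symmetric]
        by (rule sum.cong[OF refl]) (simp only: middle lessThan_iff)
      ultimately show ?thesis
        unfolding Let_def Z sum_atMost_Suc_ends top bottom x_def[symmetric]
        by (simp only: simp_thms ac_simps)
    qed
  qed
qed

end
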